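(* Let $n\ge 3$. For every $1\le k< n-1$ we have $Kf(Q_{n,k})<Kf(Q_{n,k+1})$; that is, for fixed $n$, the Kirchhoff index of the enhanced hypercube $Q_{n,k}$ is increasing in $k\in\{1,\dots,n-1\}$.
   Context: For $n\ge 2$ and $1\le k\le n-1$, the enhanced hypercube $Q_{n,k}$ is the simple graph whose vertices are the binary strings $x_1x_2\cdots x_n$ ($x_i\in\{0,1\}$), where $X=x_1\cdots x_n$ and $Y$ are adjacent iff either $Y$ is obtained from $X$ by complementing exactly one coordinate ($1\le i\le n$), or $Y=x_1\cdots x_{k-1}\overline{x_k}\,\overline{x_{k+1}}\cdots\overline{x_n}$. For a connected graph $\Gamma$, the resistance distance $r_{ij}$ between vertices $v_i,v_j$ is the effective resistance between them when every edge is a unit resistor, and the Kirchhoff index is $Kf(\Gamma)=\sum_{i<j} r_{ij}$. *)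

theory Defs
  imports
    Complex_Main
    "HOL-Library.List_Lexorder"
    "Graph_Theory.Graph_Theory"
begin

text \<open>
  As in \<^theory>\<open>Graph_Theory.Pair_Digraph\<close>, a simple graph is a symmetric loop-free set of arcs
  (\<^locale>\<open>pair_graph\<close>): each edge occurs once in either direction.
\<close>

text \<open>
  The string \<open>x\<^sub>1 \<dots> x\<^sub>n\<close> is a list of length \<open>n\<close>, so \<open>x\<^sub>i\<close> is \<open>x ! (i - 1)\<close>; the second kind of
  edge keeps the first \<open>k - 1\<close> symbols and complements \<open>x\<^sub>k \<dots> x\<^sub>n\<close>.
  Meant for \<open>1 \<le> k \<le> n - 1\<close>.
\<close>

definition enhanced_hypercube :: "nat \<Rightarrow> nat \<Rightarrow> bool list pair_pre_digraph" where
  "enhanced_hypercube n k =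
    \<lparr> pverts = {x. length x = n},
      parcs = {(x, y). length x = n \<and> length y = n \<and>
        ((\<exists>i\<in>{1..n}. y = x[i - 1 := \<not> x ! (i - 1)]) \<or>
         y = take (k - 1) x @ map Not (drop (k - 1) x))} \<rparr>"

text \<open>
  Every edge being a unit resistor, the current from \<open>x\<close> to a neighbour \<open>y\<close> is \<open>p x - p y\<close>
  (Ohm). The condition is Kirchhoff's current law when one unit of current enters at \<open>u\<close> and
  leaves at \<open>v\<close>.
\<close>

definition unit_current_potential ::
    "'a pair_pre_digraph \<Rightarrow> 'a \<Rightarrow> 'a \<Rightarrow> ('a \<Rightarrow> real) \<Rightarrow> bool" where
  "unit_current_potential G u v p \<longleftrightarrow>
    (\<forall>x\<in>pverts G. (\<Sum>y | (x, y) \<in> parcs G. p x - p y) = of_bool (x = u) - of_bool (x = v))"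

text \<open>
  On a finite connected graph such potentials exist for all vertices \<open>u\<close>, \<open>v\<close> and are unique up
  to an additive constant, so the potential difference is uniquely determined.
\<close>

definition resistance_distance :: "'a pair_pre_digraph \<Rightarrow> 'a \<Rightarrow> 'a \<Rightarrow> real" where
  "resistance_distance G u v = (THE r. \<exists>p. unit_current_potential G u v p \<and> r = p u - p v)"

text \<open>
  The linear order only serves to count each unordered pair once; since the resistance distance
  is symmetric, the sum does not depend on it.
\<close>

definition Kirchhoff_index :: "'a::linorder pair_pre_digraph \<Rightarrow> real" where
  "Kirchhoff_index G =
    (\<Sum>(u, v) \<in> {(u, v). u \<in> pverts G \<and> v \<in> pverts G \<and> u < v}. resistance_distance G u v)"

lemma finite_bool_lists: "finite {x :: bool list. length x = n}"
  using finite_lists_length_eq[of "UNIV :: bool set" n] by simp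

lemma pair_graph_enhanced_hypercube:
  assumes "1 \<le> k" "k \<le> n - 1"
  shows "pair_graph (enhanced_hypercube n k)"
proof
  fix e assume "e \<in> parcs (enhanced_hypercube n k)"
  then show "fst e \<in> pverts (enhanced_hypercube n k)" "snd e \<in> pverts (enhanced_hypercube n k)"
    by (auto simp: enhanced_hypercube_def)
next
  show "finite (pverts (enhanced_hypercube n k))"
    by (simp add: enhanced_hypercube_def finite_bool_lists)
  have "parcs (enhanced_hypercube n k) \<subseteq> {x. length x = n} \<times> {x. length x = n}"
    by (auto simp: enhanced_hypercube_def)
  then show "finite (parcs (enhanced_hypercube n k))"
    by (rule finite_subset) (simp add: finite_bool_lists)
next
  have *: "x = (x[i - 1 := \<not> x ! (i - 1)])[i - 1 := \<not> (x[i - 1 := \<not> x ! (i - 1)]) ! (i - 1)]"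
    if "i \<in> {1..n}" "length x = n" for x :: "bool list" and i
  proof -
    have "i - 1 < length x" using that by auto
    then show ?thesis by simp
  qed
  have **: "x = take (k - 1) y @ map Not (drop (k - 1) y)"
    if "length x = n" and y: "y = take (k - 1) x @ map Not (drop (k - 1) x)" for x y
    using assms that(1) unfolding y by (simp add: o_def min_def)
  show "symmetric (with_proj (enhanced_hypercube n k))"
    unfolding symmetric_def with_proj_simps
  proof (rule symI)
    fix x y assume "(x, y) \<in> parcs (enhanced_hypercube n k)"
    then have len: "length x = n" "length y = n"
      and "(\<exists>i\<in>{1..n}. y = x[i - 1 := \<not> x ! (i - 1)]) \<or>
        y = take (k - 1) x @ map Not (drop (k - 1) x)"
      by (auto simp: enhanced_hypercube_def)
    then have "(\<exists>i\<in>{1..n}. x = y[i - 1 := \<not> y ! (i - 1)]) \<or>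
        x = take (k - 1) y @ map Not (drop (k - 1) y)"
      using *[of _ x] **[of x y] by blast
    with len show "(y, x) \<in> parcs (enhanced_hypercube n k)"
      by (simp add: enhanced_hypercube_def)
  qed
next
  fix e assume e: "e \<in> parcs (enhanced_hypercube n k)"
  obtain x y where xy: "e = (x, y)" by (cases e)
  have "x \<noteq> x[i - 1 := \<not> x ! (i - 1)]" if "i \<in> {1..n}" "length x = n" for i
  proof
    assume "x = x[i - 1 := \<not> x ! (i - 1)]"
    then have "x ! (i - 1) = x[i - 1 := \<not> x ! (i - 1)] ! (i - 1)" by simp
    with that show False by auto
  qed
  moreover have "x \<noteq> take (k - 1) x @ map Not (drop (k - 1) x)" if "length x = n"
  proof
    assume "x = take (k - 1) x @ map Not (drop (k - 1) x)"
    then have "x ! (k - 1) = (take (k - 1) x @ map Not (drop (k - 1) x)) ! (k - 1)" by simp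
    with that assms show False by (auto simp: nth_append)
  qed
  ultimately show "fst e \<noteq> snd e"
    using e unfolding xy enhanced_hypercube_def by auto
qed

end

theory Submission
  imports Defs
begin

text \<open>
  The Walsh functions \<open>\<chi>\<^sub>S x = (-1)\<^bsup>|{i \<in> S. x\<^sub>i = 1}|\<^esup>\<close>, \<open>S \<subseteq> {0, \<dots>, n - 1}\<close>, diagonalise the
  Laplacian of \<open>Q\<^bsub>n,k\<^esub>\<close>, with eigenvalues \<open>\<lambda>\<^sub>k S = 2|S| + 1 - (-1)\<^bsup>|S \<inter> {k - 1, \<dots>, n - 1}|\<^esup>\<close>, and so
  \<open>Kf Q\<^bsub>n,k\<^esub> = 2\<^sup>n \<Sum>\<^bsub>S \<noteq> {}\<^esub> 1 / \<lambda>\<^sub>k S\<close>. Passing from \<open>k\<close> to \<open>k + 1\<close> only affects the sets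
  \<open>S = {k - 1} \<union> R\<close>; such a set contributes
  \<open>(-1)\<^bsup>|R \<inter> {k, \<dots>, n - 1}|\<^esup> g (|R| + 1)\<close> with \<open>g s = 1 / (2s) - 1 / (2s + 2)\<close> to the difference.
  The sum over \<open>R\<close> is a sum of iterated backward differences of \<open>g\<close>, and these are positive because
  \<open>s \<mapsto> 1 / s\<close> is completely monotone.
\<close>

section \<open>Resistance distance and Kirchhoff index\<close>

text \<open>Both sides expand into sums over arcs: the diagonal part is symmetric in
  \<open>p\<close> and \<open>q\<close>, and reversing the arcs exchanges the mixed parts.\<close>

lemma (in pair_graph) Laplacian_selfadjoint:
  fixes p q :: "'a \<Rightarrow> real"
  shows "(\<Sum>x\<in>pverts G. q x * (\<Sum>y | (x, y) \<in> parcs G. p x - p y)) =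
    (\<Sum>x\<in>pverts G. p x * (\<Sum>y | (x, y) \<in> parcs G. q x - q y))"
proof -
  have sym: "(y, x) \<in> parcs G" if "(x, y) \<in> parcs G" for x y
    using that graph_symmetric by blast
  have *: "(\<Sum>x\<in>pverts G. f x * (\<Sum>y | (x, y) \<in> parcs G. h x - h y)) =
      (\<Sum>(x, y)\<in>parcs G. f x * h x) - (\<Sum>(x, y)\<in>parcs G. f x * h y)"
    for f h :: "'a \<Rightarrow> real"
  proof -
    have fin: "finite {y. (x, y) \<in> parcs G}" for x
      by (rule finite_subset[OF _ pair_finite_verts]) (use in_arcsD2 in auto)
    have "(\<Sum>x\<in>pverts G. f x * (\<Sum>y | (x, y) \<in> parcs G. h x - h y)) =
        (\<Sum>(x, y)\<in>Sigma (pverts G) (\<lambda>x. {y. (x, y) \<in> parcs G}). f x * (h x - h y))"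
      by (simp add: sum_distrib_left sum.Sigma fin)
    also have "Sigma (pverts G) (\<lambda>x. {y. (x, y) \<in> parcs G}) = parcs G"
      using in_arcsD1 by auto
    finally show ?thesis
      by (simp add: right_diff_distrib sum_subtractf case_prod_unfold)
  qed
  have "(\<Sum>(x, y)\<in>parcs G. q x * p y) = (\<Sum>(x, y)\<in>parcs G. p x * q y)"
    by (rule sum.reindex_bij_witness[of _ prod.swap prod.swap]) (auto simp: sym)
  then show ?thesis
    unfolding * by (simp add: mult.commute)
qed

text \<open>
  Self-adjointness of the Laplacian yields uniqueness without any appeal to connectedness: testing
  a second potential \<open>q\<close> against \<open>p\<close> gives \<open>q u - q v = p u - p v\<close>.
\<close>

lemma (in pair_graph) resistance_distance_eq:
  assumes p: "unit_current_potential G u v p" and uv: "u \<in> pverts G" "v \<in> pverts G"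
  shows "resistance_distance G u v = p u - p v"
  unfolding resistance_distance_def
proof (rule the_equality)
  show "\<exists>p'. unit_current_potential G u v p' \<and> p u - p v = p' u - p' v"
    using p by blast
next
  fix r assume "\<exists>q. unit_current_potential G u v q \<and> r = q u - q v"
  then obtain q where q: "unit_current_potential G u v q" and r: "r = q u - q v" by blast
  have test: "(\<Sum>x\<in>pverts G. f x * (\<Sum>y | (x, y) \<in> parcs G. h x - h y)) = f u - f v"
    if "unit_current_potential G u v h" for f h :: "'a \<Rightarrow> real"
  proof -
    have "(\<Sum>x\<in>pverts G. f x * (\<Sum>y | (x, y) \<in> parcs G. h x - h y)) =
        (\<Sum>x\<in>pverts G. (if x = u then f x else 0) - (if x = v then f x else 0))"
      using that by (intro sum.cong) (auto simp: unit_current_potential_def)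
    also have "\<dots> = f u - f v"
      using uv by (simp add: sum_subtractf)
    finally show ?thesis .
  qed
  show "r = p u - p v"
    using Laplacian_selfadjoint[of p q] test[OF p, of q] test[OF q, of p] r by simp
qed

text \<open>Frees the Kirchhoff index from the auxiliary order: \<open>u < v\<close> and
  \<open>v < u\<close> contribute equally, the diagonal nothing.\<close>

lemma sum_ordered_pairs:
  fixes f :: "'a::linorder \<Rightarrow> 'a \<Rightarrow> real"
  assumes "finite A" and "\<And>u v. f u v = f v u" and "\<And>u. f u u = 0"
  shows "2 * (\<Sum>(u, v) \<in> {(u, v). u \<in> A \<and> v \<in> A \<and> u < v}. f u v) = (\<Sum>u\<in>A. \<Sum>v\<in>A. f u v)"
proof -
  let ?L = "{(u, v). u \<in> A \<and> v \<in> A \<and> u < v}"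
  let ?G = "{(u, v). u \<in> A \<and> v \<in> A \<and> v < u}"
  have fin: "finite ?L" "finite ?G"
    by (rule finite_subset[of _ "A \<times> A"]; use assms(1) in auto)+
  have swap: "(\<Sum>(u, v) \<in> ?G. f u v) = (\<Sum>(u, v) \<in> ?L. f u v)"
    by (rule sum.reindex_bij_witness[of _ prod.swap prod.swap]) (auto simp: assms(2))
  have "(\<Sum>u\<in>A. \<Sum>v\<in>A. f u v) = (\<Sum>(u, v) \<in> A \<times> A. f u v)"
    by (simp add: sum.cartesian_product)
  also have "\<dots> = (\<Sum>(u, v) \<in> ?L \<union> ?G. f u v)"
    by (rule sum.mono_neutral_right) (use assms in \<open>auto simp: not_less_iff_gr_or_eq\<close>)
  also have "\<dots> = (\<Sum>(u, v) \<in> ?L. f u v) + (\<Sum>(u, v) \<in> ?G. f u v)"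
    by (rule sum.union_disjoint) (use fin in auto)
  finally show ?thesis
    using swap by simp
qed

section \<open>Walsh functions\<close>

definition walsh :: "nat set \<Rightarrow> bool list \<Rightarrow> real" where
  "walsh S x = (\<Prod>i\<in>S. if x ! i then - 1 else 1)"

lemma walsh_empty [simp]: "walsh {} x = 1"
  by (simp add: walsh_def)

lemma walsh_square [simp]: "walsh S x * walsh S x = 1"
  unfolding walsh_def prod.distrib[symmetric] by (intro prod.neutral) auto

text \<open>Serves both kinds of edges: \<open>T\<close> is a singleton for a single flip and
  \<open>{k - 1..<n}\<close> for the complemented suffix.\<close>

lemma walsh_negate:
  assumes "finite S" and "\<And>i. i \<in> S \<Longrightarrow> y ! i = (if i \<in> T then \<not> x ! i else x ! i)"
  shows "walsh S y = (- 1) ^ card (S \<inter> T) * walsh S x"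
proof -
  have "walsh S y = (\<Prod>i\<in>S. (if i \<in> T then - 1 else 1) * (if x ! i then - 1 else 1))"
    unfolding walsh_def by (intro prod.cong) (auto simp: assms(2))
  also have "\<dots> = (\<Prod>i\<in>S. if i \<in> T then - 1 else 1) * walsh S x"
    by (simp add: prod.distrib walsh_def)
  also have "(\<Prod>i\<in>S. if i \<in> T then - 1 else 1 :: real) = (- 1) ^ card (S \<inter> T)"
    using assms(1) by (simp flip: prod.inter_restrict)
  finally show ?thesis .
qed

lemma walsh_flip:
  assumes "finite S" and "S \<subseteq> {..<length x}"
  shows "walsh S (x[i := \<not> x ! i]) = (if i \<in> S then - 1 else 1) * walsh S x"
proof -
  have "walsh S (x[i := \<not> x ! i]) = (- 1) ^ card (S \<inter> {i}) * walsh S x"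
    using assms by (intro walsh_negate) (auto simp: nth_list_update)
  then show ?thesis by auto
qed

text \<open>The sum over subsets is the expansion of a product over coordinates, with factor 2 where
  the strings agree and 0 where they differ.\<close>

lemma walsh_complete:
  assumes "length x = n" and "length y = n"
  shows "(\<Sum>S\<in>Pow {..<n}. walsh S x * walsh S y) = 2 ^ n * of_bool (x = y)"
proof -
  let ?s = "\<lambda>b. if b then - 1 else 1 :: real"
  have "(\<Sum>S\<in>Pow {..<n}. walsh S x * walsh S y) = (\<Prod>i<n. ?s (x ! i) * ?s (y ! i) + 1)"
    by (simp add: prod_add walsh_def prod.distrib)
  also have "\<dots> = (\<Prod>i<n. if x ! i = y ! i then 2 else 0)"
    by (intro prod.cong) auto
  also have "\<dots> = 2 ^ n * of_bool (x = y)"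
  proof (cases "x = y")
    case False
    then obtain i where "i < n" "x ! i \<noteq> y ! i"
      using assms by (auto simp: list_eq_iff_nth_eq)
    then show ?thesis
      using False by (auto intro!: prod_zero)
  qed simp
  finally show ?thesis .
qed

text \<open>Flipping a coordinate in \<open>S\<close> is an involution on the strings that negates
  the summand.\<close>

lemma sum_walsh:
  assumes S: "S \<subseteq> {..<n}" "S \<noteq> {}"
  shows "(\<Sum>x | length x = n. walsh S x) = 0"
proof -
  obtain i where i: "i \<in> S" using S by blast
  have [simp]: "finite S" using S finite_subset by blast
  have "(\<Sum>x | length x = n. walsh S x) = (\<Sum>x | length x = n. - walsh S x)"
    by (rule sum.reindex_bij_witness[of _ "\<lambda>x. x[i := \<not> x ! i]" "\<lambda>x. x[i := \<not> x ! i]"])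
      (use S i in \<open>auto simp: walsh_flip\<close>)
  then show ?thesis
    by (simp add: sum_negf)
qed

text \<open>Each square is 2 minus a cross term; the cross terms sum to a multiple of the square of
  a vanishing sum.\<close>

lemma sum_walsh_diff_square:
  assumes "S \<subseteq> {..<n}" "S \<noteq> {}"
  shows "(\<Sum>u | length u = n. \<Sum>v | length v = n. (walsh S u - walsh S v)\<^sup>2) = 2 * 4 ^ n"
proof -
  have card: "real (card {x :: bool list. length x = n}) = 2 ^ n"
    using card_lists_length_eq[of "UNIV :: bool set" n] by simp
  have "(\<Sum>u | length u = n. \<Sum>v | length v = n. (walsh S u - walsh S v)\<^sup>2) =
      (\<Sum>u | length u = n. \<Sum>v | length v = n. 2 - 2 * (walsh S u * walsh S v))"
    by (simp add: power2_eq_square algebra_simps flip: mult_2)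
  also have "\<dots> = 2 * (2 ^ n * 2 ^ n)"
    by (simp add: sum_subtractf card sum_walsh[OF assms] flip: sum_distrib_left)
  also have "\<dots> = 2 * 4 ^ n"
    by (simp flip: power_mult_distrib)
  finally show ?thesis .
qed

section \<open>The Kirchhoff index of the enhanced hypercube\<close>

lemma sum_neighbours_enhanced_hypercube:
  fixes f :: "bool list \<Rightarrow> real"
  assumes k: "1 \<le> k" "k \<le> n - 1" and x: "length x = n"
  shows "(\<Sum>y | (x, y) \<in> parcs (enhanced_hypercube n k). f y) =
    (\<Sum>i<n. f (x[i := \<not> x ! i])) + f (take (k - 1) x @ map Not (drop (k - 1) x))"
proof -
  let ?fl = "\<lambda>i. x[i := \<not> x ! i]" and ?c = "take (k - 1) x @ map Not (drop (k - 1) x)"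
  have "{1..n} = Suc ` {..<n}"
    by (simp add: image_Suc_lessThan)
  then have nb: "{y. (x, y) \<in> parcs (enhanced_hypercube n k)} = insert ?c (?fl ` {..<n})"
    using x by (auto simp: enhanced_hypercube_def)
  have inj: "inj_on ?fl {..<n}"
  proof (rule inj_onI)
    fix i j assume "i \<in> {..<n}" "j \<in> {..<n}" "?fl i = ?fl j"
    then have "?fl i ! i = ?fl j ! i" "i < length x" using x by auto
    then show "i = j" by (cases "i = j") auto
  qed
  text \<open>Needs \<open>k \<le> n - 1\<close>: the complemented suffix has at least two symbols.\<close>
  have "?c \<notin> ?fl ` {..<n}"
  proof
    assume "?c \<in> ?fl ` {..<n}"
    then obtain i where "?c = ?fl i" by blast
    then have "?c ! (k - 1) = ?fl i ! (k - 1)" "?c ! k = ?fl i ! k" by simp_all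
    then show False
      using k x by (cases "i = k") (auto simp: nth_append nth_list_update split: if_splits)
  qed
  then show ?thesis
    by (simp add: nb inj sum.reindex)
qed

definition eigenvalue :: "nat \<Rightarrow> nat \<Rightarrow> nat set \<Rightarrow> real" where
  "eigenvalue n k S = 2 * real (card S) + 1 - (- 1) ^ card (S \<inter> {k - 1..<n})"

lemma eigenvalue_pos:
  assumes "finite S" "S \<noteq> {}"
  shows "eigenvalue n k S > 0"
proof -
  have "card S > 0" using assms by (simp add: card_gt_0_iff)
  moreover have "(- 1) ^ m \<le> (1 :: real)" for m by (cases "even m") auto
  ultimately show ?thesis
    by (simp add: eigenvalue_def add_pos_nonneg add_diff_eq[symmetric])
qed

text \<open>A flip contributes 2 inside \<open>S\<close> and 0 outside; the complementing edge
  contributes 1 minus its sign.\<close>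

lemma Laplacian_walsh:
  assumes k: "1 \<le> k" "k \<le> n - 1" and x: "length x = n" and S: "S \<subseteq> {..<n}"
  shows "(\<Sum>y | (x, y) \<in> parcs (enhanced_hypercube n k). walsh S x - walsh S y) =
    eigenvalue n k S * walsh S x"
proof -
  have [simp]: "finite S" using S finite_subset by blast
  have c: "walsh S (take (k - 1) x @ map Not (drop (k - 1) x)) =
      (- 1) ^ card (S \<inter> {k - 1..<n}) * walsh S x"
    using S x by (intro walsh_negate) (auto simp: nth_append)
  have "(\<Sum>i<n. walsh S x - walsh S (x[i := \<not> x ! i])) =
      (\<Sum>i<n. if i \<in> S then 2 * walsh S x else 0)"
    using S x by (intro sum.cong) (auto simp: walsh_flip)
  also have "\<dots> = (\<Sum>i\<in>S. 2 * walsh S x)"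
    using S by (simp add: sum.inter_restrict[symmetric] Int_absorb1)
  finally show ?thesis
    by (simp add: sum_neighbours_enhanced_hypercube[OF k x] c[simplified] eigenvalue_def algebra_simps)
qed

lemma resistance_distance_enhanced_hypercube:
  assumes k: "1 \<le> k" "k \<le> n - 1" and u: "length u = n" and v: "length v = n"
  shows "resistance_distance (enhanced_hypercube n k) u v =
    (\<Sum>S\<in>Pow {..<n} - {{}}. (walsh S u - walsh S v)\<^sup>2 / eigenvalue n k S) / 2 ^ n"
proof -
  interpret pair_graph "enhanced_hypercube n k"
    by (rule pair_graph_enhanced_hypercube[OF k])
  let ?P = "Pow {..<n} - {{}}"
  \<comment> \<open>Up to \<open>2 ^ n\<close>, the Walsh coefficients of a unit source at
    \<open>u\<close> and sink at \<open>v\<close>, divided by the eigenvalues: this inverts the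
    Laplacian off the constants.\<close>
  define a where "a S = (walsh S u - walsh S v) / eigenvalue n k S" for S
  define p where "p x = (\<Sum>S\<in>?P. a S * walsh S x) / 2 ^ n" for x
  have a: "a S * eigenvalue n k S = walsh S u - walsh S v" if "S \<in> ?P" for S
    using that eigenvalue_pos[of S n k] finite_subset[of S "{..<n}"] by (auto simp: a_def)
  have "unit_current_potential (enhanced_hypercube n k) u v p"
    unfolding unit_current_potential_def
  proof
    fix x assume "x \<in> pverts (enhanced_hypercube n k)"
    then have x: "length x = n" by (simp add: enhanced_hypercube_def)
    let ?N = "{y. (x, y) \<in> parcs (enhanced_hypercube n k)}"
    have "(\<Sum>y\<in>?N. p x - p y) = (\<Sum>y\<in>?N. \<Sum>S\<in>?P. a S * (walsh S x - walsh S y)) / 2 ^ n"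
      by (simp add: p_def sum_divide_distrib[symmetric] diff_divide_distrib[symmetric]
          sum_subtractf right_diff_distrib)
    also have "\<dots> = (\<Sum>S\<in>?P. a S * (\<Sum>y\<in>?N. walsh S x - walsh S y)) / 2 ^ n"
      by (subst sum.swap) (simp add: sum_distrib_left)
    also have "\<dots> = (\<Sum>S\<in>?P. walsh S u * walsh S x - walsh S v * walsh S x) / 2 ^ n"
      using a by (simp add: Laplacian_walsh[OF k x] mult.assoc[symmetric] left_diff_distrib)
    \<comment> \<open>The term for \<open>S = {}\<close> is \<open>1 - 1 = 0\<close>; restoring it
      makes completeness applicable.\<close>
    also have "\<dots> = (\<Sum>S\<in>Pow {..<n}. walsh S u * walsh S x - walsh S v * walsh S x) / 2 ^ n"
      by (simp add: sum.remove[of "Pow {..<n}" "{}"])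
    also have "\<dots> = of_bool (x = u) - of_bool (x = v)"
      by (simp add: sum_subtractf walsh_complete u v x diff_divide_distrib eq_commute[of x])
    finally show "(\<Sum>y\<in>?N. p x - p y) = of_bool (x = u) - of_bool (x = v)" .
  qed
  then have "resistance_distance (enhanced_hypercube n k) u v = p u - p v"
    by (rule resistance_distance_eq) (simp_all add: enhanced_hypercube_def u v)
  also have "\<dots> = (\<Sum>S\<in>?P. a S * (walsh S u - walsh S v)) / 2 ^ n"
    by (simp add: p_def diff_divide_distrib[symmetric] sum_subtractf right_diff_distrib)
  finally show ?thesis
    by (simp add: a_def power2_eq_square)
qed

text \<open>Summed over all ordered pairs, the squared differences give the same value for every
  nonempty \<open>S\<close>, so only the eigenvalue depends on \<open>S\<close>.\<close>

lemma Kirchhoff_index_enhanced_hypercube: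
  assumes k: "1 \<le> k" "k \<le> n - 1"
  shows "Kirchhoff_index (enhanced_hypercube n k) =
    2 ^ n * (\<Sum>S\<in>Pow {..<n} - {{}}. 1 / eigenvalue n k S)"
proof -
  let ?P = "Pow {..<n} - {{}}" and ?V = "{x :: bool list. length x = n}"
  define f where
    "f u v = (\<Sum>S\<in>?P. (walsh S u - walsh S v)\<^sup>2 / eigenvalue n k S) / 2 ^ n" for u v
  have "Kirchhoff_index (enhanced_hypercube n k) =
      (\<Sum>(u, v) \<in> {(u, v). u \<in> ?V \<and> v \<in> ?V \<and> u < v}. f u v)"
  proof -
    have "pverts (enhanced_hypercube n k) = ?V"
      by (simp add: enhanced_hypercube_def)
    then show ?thesis
      unfolding Kirchhoff_index_def
      by (intro sum.cong)
        (use resistance_distance_enhanced_hypercube[OF k] in \<open>auto simp: f_def\<close>)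
  qed
  moreover have "f u v = f v u" "f u u = 0" for u v
    by (simp_all add: f_def power2_commute)
  ultimately have "2 * Kirchhoff_index (enhanced_hypercube n k) = (\<Sum>u\<in>?V. \<Sum>v\<in>?V. f u v)"
    using sum_ordered_pairs[OF finite_bool_lists[of n], of f] by metis
  also have "\<dots> = (\<Sum>u\<in>?V. \<Sum>S\<in>?P. \<Sum>v\<in>?V. (walsh S u - walsh S v)\<^sup>2 / eigenvalue n k S) / 2 ^ n"
    unfolding f_def sum_divide_distrib[symmetric]
    by (subst sum.swap) (simp add: sum_divide_distrib)
  also have "\<dots> = (\<Sum>S\<in>?P. (\<Sum>u\<in>?V. \<Sum>v\<in>?V. (walsh S u - walsh S v)\<^sup>2) / eigenvalue n k S) / 2 ^ n"
    unfolding sum_divide_distrib[symmetric] by (subst sum.swap) (simp add: sum_divide_distrib)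
  also have "\<dots> = (\<Sum>S\<in>?P. 2 * 4 ^ n / eigenvalue n k S) / 2 ^ n"
    by (simp add: sum_walsh_diff_square)
  also have "\<dots> = 2 * 2 ^ n * (\<Sum>S\<in>?P. 1 / eigenvalue n k S)"
  proof -
    have "(4 :: real) ^ n = 2 ^ n * 2 ^ n" by (simp flip: power_mult_distrib)
    then show ?thesis by (simp add: sum_distrib_left sum_divide_distrib)
  qed
  finally show ?thesis by simp
qed

section \<open>Complete monotonicity\<close>

text \<open>The \<open>m\<close>-fold backward difference of \<open>c \<mapsto> 1 / c\<close>.\<close>

definition reciprocal_diff :: "nat \<Rightarrow> real \<Rightarrow> real" where
  "reciprocal_diff m c = fact m / pochhammer c (Suc m)"

lemma reciprocal_diff_pos: "c > 0 \<Longrightarrow> reciprocal_diff m c > 0"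
  by (simp add: reciprocal_diff_def pochhammer_pos)

lemma reciprocal_diff_Suc:
  assumes "c > 0"
  shows "reciprocal_diff m c - reciprocal_diff m (c + 1) = reciprocal_diff (Suc m) c"
proof -
  \<comment> \<open>The factor common to all denominators; what remains is
    \<open>1 / c - 1 / (c + 1 + m) = (m + 1) / (c * (c + 1 + m))\<close>.\<close>
  define P where "P = pochhammer (c + 1) m"
  have "P > 0" using assms by (simp add: P_def pochhammer_pos)
  have "pochhammer c (Suc m) = c * P" "pochhammer (c + 1) (Suc m) = P * (c + 1 + m)"
    "pochhammer c (Suc (Suc m)) = c * (P * (c + 1 + m))"
    by (simp_all only: P_def pochhammer_rec[of c] pochhammer_Suc[of "c + 1"])
  then show ?thesis
    using assms \<open>P > 0\<close> by (simp add: reciprocal_diff_def divide_simps) (simp add: algebra_simps)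
qed

lemma sum_Pow_insert:
  assumes "finite A" "a \<notin> A"
  shows "sum f (Pow (insert a A)) = sum f (Pow A) + (\<Sum>R\<in>Pow A. f (insert a R))"
proof -
  have "inj_on (insert a) (Pow A)"
    using assms(2) by (auto simp: inj_on_def)
  moreover have "sum f (Pow (insert a A)) = sum f (Pow A) + sum f (insert a ` Pow A)"
    unfolding Pow_insert by (rule sum.union_disjoint) (use assms in auto)
  ultimately show ?thesis
    by (simp add: sum.reindex)
qed

text \<open>
  Each element of \<open>A \<inter> T\<close> applies one more backward difference, each element of \<open>A - T\<close> adds two
  positive quantities.
\<close>

lemma signed_sum_reciprocal_diff_pos:
  assumes "finite A" "c > 0"
  shows "(\<Sum>R\<in>Pow A. (- 1) ^ card (R \<inter> T) * reciprocal_diff m (c + card R)) > 0"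
  using assms
proof (induction A arbitrary: m c rule: finite_induct)
  case empty
  then show ?case by (simp add: reciprocal_diff_pos)
next
  case (insert a A)
  have card: "card (insert a R) = Suc (card R)"
    "card (insert a R \<inter> T) = (if a \<in> T then Suc (card (R \<inter> T)) else card (R \<inter> T))"
    if "R \<in> Pow A" for R
  proof -
    have "finite R" "a \<notin> R" using that insert.hyps finite_subset by auto
    then show "card (insert a R) = Suc (card R)"
      "card (insert a R \<inter> T) = (if a \<in> T then Suc (card (R \<inter> T)) else card (R \<inter> T))"
      by (auto simp: Int_insert_left)
  qed
  let ?s = "\<lambda>R. (- 1) ^ card (R \<inter> T) :: real"
  have "(\<Sum>R\<in>Pow (insert a A). ?s R * reciprocal_diff m (c + card R)) =
      (\<Sum>R\<in>Pow A. ?s R * reciprocal_diff m (c + card R)) +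
      (\<Sum>R\<in>Pow A. (if a \<in> T then - 1 else 1) * (?s R * reciprocal_diff m (c + 1 + card R)))"
    unfolding sum_Pow_insert[OF insert.hyps]
    by (intro arg_cong2[where f = "(+)"] sum.cong refl) (simp add: card add.assoc)
  also have "\<dots> > 0"
  proof (cases "a \<in> T")
    case True
    have "?s R * reciprocal_diff m (c + card R) - ?s R * reciprocal_diff m (c + 1 + card R) =
        ?s R * reciprocal_diff (Suc m) (c + card R)" for R
      using reciprocal_diff_Suc[of "c + card R" m] insert.prems
      by (simp add: right_diff_distrib[symmetric] add_ac)
    then show ?thesis
      using True insert.IH[of c "Suc m"] insert.prems
      by (simp add: sum_negf flip: sum_subtractf)
  next
    case False
    then show ?thesis
      using insert.IH[of c m] insert.IH[of "c + 1" m] insert.prems by simp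
  qed
  finally show ?case .
qed

lemma eigenvalue_Suc_irrelevant:
  assumes "1 \<le> k" "k - 1 \<notin> S"
  shows "eigenvalue n (k + 1) S = eigenvalue n k S"
proof -
  have "i \<noteq> k - 1" if "i \<in> S" for i using that assms(2) by blast
  then have "S \<inter> {k - 1..<n} = S \<inter> {k..<n}"
    using assms(1) by force
  then show ?thesis by (simp add: eigenvalue_def)
qed

text \<open>The index \<open>k - 1\<close> lies in the suffix for \<open>k\<close> but not in that
  for \<open>k + 1\<close>, so the two eigenvalues differ only in the sign of \<open>s\<close>. As
  \<open>s\<close> is 1 or -1, it factors out of the difference of reciprocals.\<close>

lemma inverse_eigenvalue_diff:
  assumes k: "1 \<le> k" "k \<le> n" and R: "finite R" "k - 1 \<notin> R"
  shows "1 / eigenvalue n (k + 1) (insert (k - 1) R) - 1 / eigenvalue n k (insert (k - 1) R) =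
    (- 1) ^ card (R \<inter> {k..<n}) * reciprocal_diff 1 (1 + card R) / 2"
proof -
  have "{k - 1..<n} = insert (k - 1) {k..<n}"
    using k by auto
  then have T: "card (insert (k - 1) R \<inter> {k - 1..<n}) = Suc (card (R \<inter> {k..<n}))"
      "insert (k - 1) R \<inter> {k..<n} = R \<inter> {k..<n}"
    using k R by (auto simp: Int_insert_left)
  define c :: real where "c = card R"
  define s :: real where "s = (- 1) ^ card (R \<inter> {k..<n})"
  have "c \<ge> 0" "s = 1 \<or> s = - 1"
    unfolding c_def s_def by (auto simp: minus_one_power_iff)
  moreover have "eigenvalue n (k + 1) (insert (k - 1) R) = 2 * c + 3 - s"
      "eigenvalue n k (insert (k - 1) R) = 2 * c + 3 + s"
    using R T by (simp_all add: eigenvalue_def c_def s_def)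
  moreover have "reciprocal_diff 1 (1 + card R) = 1 / ((c + 1) * (c + 2))"
    by (simp add: reciprocal_diff_def pochhammer_Suc c_def add_ac)
  moreover have "1 / (2 + 2 * c) - 1 / (4 + 2 * c) = 1 / ((c + 1) * (c + 2)) / 2"
    using \<open>c \<ge> 0\<close> by (simp add: divide_simps) (simp add: algebra_simps)
  ultimately show ?thesis
    unfolding s_def[symmetric] by auto
qed

theorem theorem5:
  fixes n k :: nat
  assumes "n \<ge> 3"
    and "1 \<le> k"
    and "k < n - 1"
  shows "Kirchhoff_index (enhanced_hypercube n k) < Kirchhoff_index (enhanced_hypercube n (k + 1))"
proof -
  let ?A = "{..<n} - {k - 1}"
  define d where "d S = 1 / eigenvalue n (k + 1) S - 1 / eigenvalue n k S" for S
  have N: "insert (k - 1) ?A = {..<n}" using assms by auto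
  \<comment> \<open>Both eigenvalues vanish at \<open>{}\<close>, so \<open>d {} = 0\<close> with
    the convention \<open>1 / 0 = 0\<close>.\<close>
  have "(\<Sum>S\<in>Pow {..<n} - {{}}. d S) = (\<Sum>S\<in>Pow {..<n}. d S)"
    by (rule sum.mono_neutral_left) (auto simp: d_def eigenvalue_def)
  also have "\<dots> = (\<Sum>R\<in>Pow ?A. d R) + (\<Sum>R\<in>Pow ?A. d (insert (k - 1) R))"
    by (subst N[symmetric], rule sum_Pow_insert) auto
  also have "(\<Sum>R\<in>Pow ?A. d R) = 0"
    unfolding d_def
    by (intro sum.neutral ballI) (subst eigenvalue_Suc_irrelevant, use assms in auto)
  also have "(\<Sum>R\<in>Pow ?A. d (insert (k - 1) R)) =
      (\<Sum>R\<in>Pow ?A. (- 1) ^ card (R \<inter> {k..<n}) * reciprocal_diff 1 (1 + card R)) / 2"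
    unfolding sum_divide_distrib d_def
    by (intro sum.cong refl inverse_eigenvalue_diff)
      (use assms in \<open>auto intro: finite_subset[of _ "{..<n}"]\<close>)
  \<comment> \<open>The summand is already a first difference, hence \<open>m = 1\<close>; the shift
    \<open>c = 1\<close> counts the element \<open>k - 1\<close>.\<close>
  also have "0 + \<dots> > 0"
    using signed_sum_reciprocal_diff_pos[of ?A 1 "{k..<n}" 1] by simp
  finally have "(\<Sum>S\<in>Pow {..<n} - {{}}. d S) > 0" .
  then have "(\<Sum>S\<in>Pow {..<n} - {{}}. 1 / eigenvalue n k S) <
      (\<Sum>S\<in>Pow {..<n} - {{}}. 1 / eigenvalue n (k + 1) S)"
    by (simp add: d_def sum_subtractf)
  \<comment> \<open>By \<open>k < n - 1\<close> the spectral formula is available for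
    \<open>k + 1\<close> as well as for \<open>k\<close>.\<close>
  then show ?thesis
    using assms by (simp add: Kirchhoff_index_enhanced_hypercube del: One_nat_def)
qed

end
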